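(* Let $D$ be a domain in $\mathbb{R}^2$ and let $u$ be metaharmonic in $D$, i.e. $u$ is a real-valued $C^2(D)$ solution of $\nabla^2 u + \lambda^2 u = 0$ for some $\lambda \in \mathbb{R}\setminus\{0\}$. Then $$\tilde a(\lambda r)\,u(x) = \frac{1}{\pi r^2}\int_{B_r(x)} u(y)\,\log\frac{r}{|x-y|}\,\mathrm{d}y, \qquad \tilde a(t) = \frac{2\,[1-J_0(t)]}{t^2},$$ for every $x \in D$ and every $r>0$ with $\overline{B_r(x)} \subset D$.
   Context: $B_r(x) = \{y : |y-x| < r\}$ is the open disc; $J_0$ is the Bessel function of the first kind of order $0$. *)

theory Defs
  imports "HOL-Analysis.Analysis"
begin

definition bessel_J0 :: "real \<Rightarrow> real" where
  "bessel_J0 t = (\<Sum>k. (-1) ^ k * (t / 2) ^ (2 * k) / (fact k) ^ 2)"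

definition a_tilde :: "real \<Rightarrow> real" where
  "a_tilde t = 2 * (1 - bessel_J0 t) / t ^ 2"

definition partial :: "2 \<Rightarrow> (real^2 \<Rightarrow> real) \<Rightarrow> real^2 \<Rightarrow> real" where
  "partial i f x = frechet_derivative f (at x) (axis i 1)"

definition C1_on :: "(real^2) set \<Rightarrow> (real^2 \<Rightarrow> real) \<Rightarrow> bool" where
  "C1_on D f \<longleftrightarrow> (\<forall>x\<in>D. f differentiable (at x)) \<and> (\<forall>i. continuous_on D (partial i f))"

definition C2_on :: "(real^2) set \<Rightarrow> (real^2 \<Rightarrow> real) \<Rightarrow> bool" where
  "C2_on D f \<longleftrightarrow> C1_on D f \<and> (\<forall>i. C1_on D (partial i f))"

definition laplacian :: "(real^2 \<Rightarrow> real) \<Rightarrow> real^2 \<Rightarrow> real" where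
  "laplacian f x = (\<Sum>i\<in>UNIV. partial i (partial i f) x)"

end

theory Submission
  imports Defs "HOL-Real_Asymp.Real_Asymp"
begin

text \<open>Let \<open>\<phi> s\<close> be the integral of \<open>u\<close> over the angle on the circle of radius \<open>s\<close> about \<open>x\<close>.
  Averaging the Helmholtz equation gives \<open>(s \<phi>')' = - lam\<^sup>2 s \<phi>\<close>, whence
  \<open>\<phi> s = 2 \<pi> u(x) J\<^sub>0(lam s)\<close> because the regular solution is determined by its value at \<open>0\<close>.
  In polar coordinates the integral over the disc is that of \<open>\<phi> s * s ln (r / s)\<close> over \<open>[0, r]\<close>,
  and \<open>- (s \<phi>' ln (r / s) + \<phi>) / lam\<^sup>2\<close> is an antiderivative.\<close>

subsection \<open>Bessel's equation of order zero\<close>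

text \<open>Domination by the exponential series. Convergence for every \<open>y\<close> is what
  permits termwise differentiation on the whole line.\<close>

lemma summable_inverse_fact_square:
  fixes y :: real
  shows "summable (\<lambda>n. inverse ((fact n)\<^sup>2) * y ^ n)"
proof (rule summable_comparison_test)
  show "\<exists>N. \<forall>n\<ge>N. norm (inverse ((fact n)\<^sup>2) * y ^ n) \<le> inverse (fact n) * \<bar>y\<bar> ^ n"
  proof (intro exI allI impI)
    fix n :: nat
    have "(fact n :: real) \<le> (fact n)\<^sup>2"
      by (rule self_le_power) (auto simp: fact_ge_1)
    then have "inverse ((fact n)\<^sup>2) \<le> inverse (fact n :: real)"
      by (intro le_imp_inverse_le) auto
    then show "norm (inverse ((fact n)\<^sup>2) * y ^ n) \<le> inverse (fact n) * \<bar>y\<bar> ^ n"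
      by (simp add: abs_mult power_abs mult_right_mono)
  qed
  show "summable (\<lambda>n. inverse (fact n) * \<bar>y\<bar> ^ n)"
    by (rule summable_exp)
qed

text \<open>Keeping the coefficients as an argument lets derivatives of every order be written in
  the same form, with \<open>diffs\<close> applied to \<open>c\<close>.\<close>

definition power_series :: "(nat \<Rightarrow> real) \<Rightarrow> real \<Rightarrow> real" where
  "power_series c z = (\<Sum>n. c n * z ^ n)"

abbreviation bessel_coeff :: "nat \<Rightarrow> real" where
  "bessel_coeff n \<equiv> inverse ((fact n)\<^sup>2)"

text \<open>The substitution z = -t^2/4 absorbs the signs and the even powers and leaves a plain
  power series in z.\<close>

lemma bessel_J0_eq_power_series: "bessel_J0 t = power_series bessel_coeff (- t\<^sup>2 / 4)"
proof -
  have "(-1) ^ k * (t / 2) ^ (2 * k) / (fact k)\<^sup>2 = bessel_coeff k * (- t\<^sup>2 / 4) ^ k" for k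
  proof -
    have "- t\<^sup>2 / 4 = - 1 * (t / 2)\<^sup>2"
      by (simp add: power2_eq_square)
    then have "(- t\<^sup>2 / 4) ^ k = (-1) ^ k * (t / 2) ^ (2 * k)"
      by (simp only: power_mult_distrib power_mult)
    then show ?thesis by (simp only: divide_inverse mult_ac)
  qed
  then show ?thesis by (simp add: bessel_J0_def power_series_def)
qed

lemma power_series_deriv:
  assumes "\<And>y. summable (\<lambda>n. c n * y ^ n)"
  shows "(power_series c has_field_derivative power_series (diffs c) z) (at z)"
  unfolding power_series_def by (rule termdiffs_strong_converges_everywhere) (rule assms)

text \<open>Comparison of coefficients: the left side has n-th coefficient (n+1)^2 c(n+1), and this
  is c(n) for c(n) = 1/(n!)^2.\<close>

lemma bessel_power_series_ode:
  "z * power_series (diffs (diffs bessel_coeff)) z + power_series (diffs bessel_coeff) z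
     = power_series bessel_coeff z"
proof -
  let ?c = bessel_coeff
  note s0 = summable_inverse_fact_square
  have s1: "summable (\<lambda>n. diffs ?c n * y ^ n)" for y
    by (rule termdiff_converges_all) (rule s0)
  have s2: "summable (\<lambda>n. diffs (diffs ?c) n * y ^ n)" for y
    by (rule termdiff_converges_all) (rule s1)
  have "(\<lambda>n. diffs (diffs ?c) n * z ^ n) sums power_series (diffs (diffs ?c)) z"
    unfolding power_series_def by (rule summable_sums) (rule s2)
  then have "(\<lambda>n. z * (diffs (diffs ?c) n * z ^ n)) sums (z * power_series (diffs (diffs ?c)) z)"
    by (rule sums_mult)
  moreover have "(\<lambda>n. z * (diffs (diffs ?c) n * z ^ n)) =
      (\<lambda>n. real (Suc n) * diffs ?c (Suc n) * z ^ Suc n)"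
    by (auto simp: diffs_def)
  ultimately have
    "(\<lambda>n. real (Suc n) * diffs ?c (Suc n) * z ^ Suc n) sums (z * power_series (diffs (diffs ?c)) z)"
    by simp
  \<comment> \<open>The index is shifted back by one. The new term at n = 0 carries the factor n, so
    the sum does not change.\<close>
  then have "(\<lambda>n. real n * diffs ?c n * z ^ n) sums (z * power_series (diffs (diffs ?c)) z)"
    using sums_Suc_iff[of "\<lambda>n. real n * diffs ?c n * z ^ n"] by simp
  moreover have "(\<lambda>n. diffs ?c n * z ^ n) sums power_series (diffs ?c) z"
    unfolding power_series_def by (rule summable_sums) (rule s1)
  ultimately have
    "(\<lambda>n. real n * diffs ?c n * z ^ n + diffs ?c n * z ^ n) sums
      (z * power_series (diffs (diffs ?c)) z + power_series (diffs ?c) z)"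
    by (rule sums_add)
  moreover have "real n * diffs ?c n * z ^ n + diffs ?c n * z ^ n = ?c n * z ^ n" for n
  proof -
    have "real n * diffs ?c n + diffs ?c n = real (Suc n) * (real (Suc n) * inverse ((real (Suc n) * fact n)\<^sup>2))"
      by (simp add: diffs_def algebra_simps)
    also have "\<dots> = ?c n"
      by (simp add: power_mult_distrib power2_eq_square field_simps del: of_nat_Suc)
    finally have "real n * diffs ?c n + diffs ?c n = ?c n" .
    then show ?thesis by (metis distrib_right)
  qed
  ultimately show ?thesis
    unfolding power_series_def by (simp add: sums_iff)
qed

lemma bessel_J0_0: "bessel_J0 0 = 1"
  using powser_zero[of bessel_coeff] by (simp add: bessel_J0_eq_power_series power_series_def)

text \<open>Chain rule through z = -t^2/4, which turns z G'' + G' = G into Bessel's equation. The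
  form multiplied by \<open>t\<close> makes sense at 0 as well.\<close>

lemma bessel_J0_derivs:
  obtains j1 j2 where
    "\<And>t. (bessel_J0 has_real_derivative j1 t) (at t)"
    "\<And>t. (j1 has_real_derivative j2 t) (at t)"
    "\<And>t. j1 t + t * j2 t = - t * bessel_J0 t"
    "j1 0 = 0"
proof
  let ?G = "power_series bessel_coeff" and ?G1 = "power_series (diffs bessel_coeff)"
    and ?G2 = "power_series (diffs (diffs bessel_coeff))"
  define j1 where "j1 t = - t / 2 * ?G1 (- t\<^sup>2 / 4)" for t
  define j2 where "j2 t = - 1 / 2 * ?G1 (- t\<^sup>2 / 4) + t\<^sup>2 / 4 * ?G2 (- t\<^sup>2 / 4)" for t
  have G: "(?G has_field_derivative ?G1 z) (at z)" for z
    by (rule power_series_deriv) (rule summable_inverse_fact_square)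
  have G1: "(?G1 has_field_derivative ?G2 z) (at z)" for z
    by (intro power_series_deriv termdiff_converges_all summable_inverse_fact_square)
  have q: "((\<lambda>t. - t\<^sup>2 / 4) has_real_derivative - t / 2) (at t)" for t :: real
    by (auto intro!: derivative_eq_intros)
  show "(bessel_J0 has_real_derivative j1 t) (at t)" for t
    using DERIV_chain2[OF G q] by (simp add: bessel_J0_eq_power_series[abs_def] j1_def mult.commute)
  show "(j1 has_real_derivative j2 t) (at t)" for t
  proof -
    have "((\<lambda>t. - t / 2 * ?G1 (- t\<^sup>2 / 4)) has_real_derivative
        - 1 / 2 * ?G1 (- t\<^sup>2 / 4) + (?G2 (- t\<^sup>2 / 4) * (- t / 2)) * (- t / 2)) (at t)"
      by (rule DERIV_mult'[OF _ DERIV_chain2[OF G1 q], THEN DERIV_cong])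
        (auto intro!: derivative_eq_intros)
    then show ?thesis
      by (simp add: j1_def[abs_def] j2_def power2_eq_square mult_ac)
  qed
  show "j1 t + t * j2 t = - t * bessel_J0 t" for t
    unfolding j1_def j2_def bessel_J0_eq_power_series bessel_power_series_ode[symmetric, of "- t\<^sup>2 / 4"]
    by (simp add: algebra_simps power2_eq_square)
  show "j1 0 = 0" by (simp add: j1_def)
qed

section \<open>Uniqueness of the regular solution\<close>

text \<open>The energy \<open>f1\<^sup>2 + lam\<^sup>2 f\<^sup>2\<close> is nonincreasing because of the damping term.\<close>
lemma bessel_ode_zero:
  fixes f f1 f2 :: "real \<Rightarrow> real"
  assumes f: "\<And>s. s \<in> {0..r} \<Longrightarrow> (f has_real_derivative f1 s) (at s within {0..r})"
    and f1: "\<And>s. s \<in> {0..r} \<Longrightarrow> (f1 has_real_derivative f2 s) (at s within {0..r})"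
    and ode: "\<And>s. s \<in> {0<..<r} \<Longrightarrow> f1 s + s * f2 s = - lam\<^sup>2 * s * f s"
    and init: "f 0 = 0" "f1 0 = 0"
    and "lam \<noteq> 0" "0 \<le> r"
  shows "f r = 0"
proof -
  define E where "E s = (f1 s)\<^sup>2 + lam\<^sup>2 * (f s)\<^sup>2" for s
  have cont: "continuous_on {0..r} f" "continuous_on {0..r} f1"
    using DERIV_continuous_on[of "{0..r}" f] DERIV_continuous_on[of "{0..r}" f1] f f1 by blast+
  have "E 0 \<ge> E r"
  \<comment> \<open>Derivatives are examined only at interior points, so the singular damping
    coefficient 1/s never meets s = 0. Continuity covers the endpoints.\<close>
  proof (rule DERIV_nonpos_imp_decreasing_open[OF \<open>0 \<le> r\<close>])
    show "continuous_on {0..r} E"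
      unfolding E_def by (intro continuous_intros cont)
    fix s assume s: "0 < s" "s < r"
    then have at: "at s within {0..r} = at s"
      by (intro at_within_interior) auto
    have d: "(f has_real_derivative f1 s) (at s)" "(f1 has_real_derivative f2 s) (at s)"
      using f[of s] f1[of s] s at by auto
    have "(E has_real_derivative 2 * f1 s * (f2 s + lam\<^sup>2 * f s)) (at s)"
      unfolding E_def by (rule derivative_eq_intros d refl | simp add: algebra_simps)+
    moreover have "f2 s + lam\<^sup>2 * f s = - f1 s / s"
      using ode[of s] s by (simp add: field_simps)
    ultimately have "(E has_real_derivative - 2 * (f1 s)\<^sup>2 / s) (at s)"
      by (simp add: power2_eq_square mult.assoc)
    then show "\<exists>y. (E has_real_derivative y) (at s) \<and> y \<le> 0"
      using s by (intro exI conjI) auto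
  qed
  then have "E r \<le> 0" by (simp add: E_def init)
  moreover have "0 \<le> (f1 r)\<^sup>2" "0 \<le> lam\<^sup>2 * (f r)\<^sup>2" by auto
  ultimately have "lam\<^sup>2 * (f r)\<^sup>2 = 0" unfolding E_def by linarith
  then show ?thesis using \<open>lam \<noteq> 0\<close> by simp
qed

text \<open>The equation is linear and is also solved by \<open>bessel_J0 (lam * s)\<close>.
  Subtracting \<open>f 0\<close> times that solution leaves zero initial data, because J0 is 1 and
  has derivative 0 at the origin.\<close>

lemma bessel_ode_unique:
  fixes f f1 f2 :: "real \<Rightarrow> real"
  assumes f: "\<And>s. s \<in> {0..r} \<Longrightarrow> (f has_real_derivative f1 s) (at s within {0..r})"
    and f1: "\<And>s. s \<in> {0..r} \<Longrightarrow> (f1 has_real_derivative f2 s) (at s within {0..r})"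
    and ode: "\<And>s. s \<in> {0<..<r} \<Longrightarrow> f1 s + s * f2 s = - lam\<^sup>2 * s * f s"
    and "f1 0 = 0" "lam \<noteq> 0" "0 \<le> r"
  shows "f r = f 0 * bessel_J0 (lam * r)"
proof -
  obtain j1 j2 where j: "\<And>t. (bessel_J0 has_real_derivative j1 t) (at t)"
    "\<And>t. (j1 has_real_derivative j2 t) (at t)"
    "\<And>t. j1 t + t * j2 t = - t * bessel_J0 t" "j1 0 = 0"
    using bessel_J0_derivs by blast
  have J: "((\<lambda>s. bessel_J0 (lam * s)) has_real_derivative lam * j1 (lam * s)) (at s within {0..r})" for s
    using DERIV_chain2[OF j(1) DERIV_cmult_Id[of lam s]]
    by (metis has_field_derivative_at_within mult.commute)
  have J1: "((\<lambda>s. j1 (lam * s)) has_real_derivative lam * j2 (lam * s)) (at s within {0..r})" for s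
    using DERIV_chain2[OF j(2) DERIV_cmult_Id[of lam s]]
    by (metis has_field_derivative_at_within mult.commute)
  have "f r - f 0 * bessel_J0 (lam * r) = 0"
  proof (rule bessel_ode_zero[where f = "\<lambda>s. f s - f 0 * bessel_J0 (lam * s)"])
    fix s assume s: "s \<in> {0..r}"
    show "((\<lambda>s. f s - f 0 * bessel_J0 (lam * s)) has_real_derivative
        f1 s - f 0 * (lam * j1 (lam * s))) (at s within {0..r})"
      by (intro DERIV_diff f s DERIV_cmult J)
    show "((\<lambda>s. f1 s - f 0 * (lam * j1 (lam * s))) has_real_derivative
        f2 s - f 0 * (lam * (lam * j2 (lam * s)))) (at s within {0..r})"
      by (intro DERIV_diff f1 s DERIV_cmult J1)
  next
    fix s assume s: "s \<in> {0<..<r}"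
    \<comment> \<open>Bessel's equation at \<open>lam * s\<close>, multiplied by \<open>lam\<close>:
      each derivative in s of the rescaled function brings out one factor
      \<open>lam\<close>.\<close>
    have "lam * (j1 (lam * s) + (lam * s) * j2 (lam * s)) = lam * (- (lam * s) * bessel_J0 (lam * s))"
      by (simp only: j(3))
    then have "f 0 * (lam * (j1 (lam * s) + (lam * s) * j2 (lam * s))) =
      f 0 * (lam * (- (lam * s) * bessel_J0 (lam * s)))" by simp
    then show "f1 s - f 0 * (lam * j1 (lam * s)) + s * (f2 s - f 0 * (lam * (lam * j2 (lam * s))))
        = - lam\<^sup>2 * s * (f s - f 0 * bessel_J0 (lam * s))"
      using ode[OF s] by (simp add: algebra_simps power2_eq_square)
  qed (use assms j(4) in \<open>auto simp: bessel_J0_0\<close>)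
  then show ?thesis by simp
qed

section \<open>Integration against the logarithmic weight\<close>

lemma has_integral_log_weight_bessel_ode:
  fixes f f1 f2 :: "real \<Rightarrow> real"
  assumes f: "\<And>s. s \<in> {0..r} \<Longrightarrow> (f has_real_derivative f1 s) (at s within {0..r})"
    and f1: "\<And>s. s \<in> {0..r} \<Longrightarrow> (f1 has_real_derivative f2 s) (at s within {0..r})"
    and ode: "\<And>s. s \<in> {0<..<r} \<Longrightarrow> f1 s + s * f2 s = - lam\<^sup>2 * s * f s"
    and "lam \<noteq> 0" "0 < r"
    and cont_log: "continuous_on {0..r} (\<lambda>s. s * ln (r / s))"
  shows "((\<lambda>s. f s * (s * ln (r / s))) has_integral (f 0 - f r) / lam\<^sup>2) {0..r}"
proof -
  \<comment> \<open>Found by integration by parts: the equation reads f s = -(s f1)' / lam^2, and s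
    f1 times the derivative -1/s of the logarithm gives -f1, which the summand \<open>f s\<close>
    compensates.\<close>
  define H where "H s = - (f1 s * (s * ln (r / s)) + f s) / lam\<^sup>2" for s
  have cont: "continuous_on {0..r} f" "continuous_on {0..r} f1"
    using DERIV_continuous_on[of "{0..r}" f] DERIV_continuous_on[of "{0..r}" f1] f f1 by blast+
  have "((\<lambda>s. f s * (s * ln (r / s))) has_integral (H r - H 0)) {0..r}"
  proof (rule fundamental_theorem_of_calculus_interior)
    show "continuous_on {0..r} H"
      unfolding H_def using \<open>lam \<noteq> 0\<close> by (intro continuous_intros cont cont_log) auto
    fix s assume s: "s \<in> {0<..<r}"
    then have at: "at s within {0..r} = at s"
      by (intro at_within_interior) auto
    have d: "(f has_real_derivative f1 s) (at s)" "(f1 has_real_derivative f2 s) (at s)"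
      using f[of s] f1[of s] s at by auto
    have l: "((\<lambda>s. s * ln (r / s)) has_real_derivative ln (r / s) - 1) (at s)"
      using s by (auto intro!: derivative_eq_intros simp: field_simps power2_eq_square)
    have "(H has_real_derivative - ((f1 s + s * f2 s) * ln (r / s)) / lam\<^sup>2) (at s)"
      unfolding H_def
      by (rule DERIV_cdivide[OF DERIV_minus[OF DERIV_add[OF DERIV_mult'[OF d(2) l] d(1)]], THEN DERIV_cong])
        (simp add: algebra_simps)
    then show "(H has_vector_derivative f s * (s * ln (r / s))) (at s)"
      using ode[OF s] \<open>lam \<noteq> 0\<close>
      by (simp add: has_real_derivative_iff_has_vector_derivative mult_ac)
  qed (use \<open>0 < r\<close> in simp)
  \<comment> \<open>The product \<open>s * ln (r / s)\<close> vanishes at both ends: at 0 by the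
    factor s, at r because ln 1 = 0.\<close>
  moreover have "H r - H 0 = (f 0 - f r) / lam\<^sup>2"
    using \<open>0 < r\<close> by (simp add: H_def diff_divide_distrib)
  ultimately show ?thesis by simp
qed

text \<open>Only s = 0 is delicate. There the product tends to 0, which is also its value.\<close>

lemma continuous_on_mult_ln_div:
  fixes r :: real
  assumes "0 < r"
  shows "continuous_on {0..r} (\<lambda>s. s * ln (r / s))"
proof -
  have "continuous (at s within {0..r}) (\<lambda>s. s * ln (r / s))" if "s \<in> {0..r}" for s
  proof (cases "s = 0")
    case True
    have "((\<lambda>s. s * ln (r / s)) \<longlongrightarrow> 0) (at_right 0)"
      using assms by real_asymp
    then have "((\<lambda>s. s * ln (r / s)) \<longlongrightarrow> 0) (at 0 within {0..r})"
      using assms by (simp add: at_within_Icc_at_right)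
    then show ?thesis using True by (simp add: continuous_within)
  next
    case False
    then show ?thesis using that assms by (intro continuous_intros) auto
  qed
  then show ?thesis by (simp add: continuous_on_eq_continuous_within)
qed

subsection \<open>Polar coordinates in the plane\<close>

lemma bounded_linear_vector_2:
  "bounded_linear (\<lambda>p :: real \<times> real. vector [fst p, snd p] :: real^2)"
proof -
  have "linear (\<lambda>p :: real \<times> real. vector [fst p, snd p] :: real^2)"
    by (intro linearI) (auto simp: vec_eq_iff forall_2)
  then show ?thesis by (simp add: linear_conv_bounded_linear)
qed

lemma vector_2_mem_box:
  "vector [a, b] \<in> box l u \<longleftrightarrow> (a, b) \<in> box (l $ 1, l $ 2) (u $ 1, u $ 2)"
  "vector [a, b] \<in> cbox l u \<longleftrightarrow> (a, b) \<in> cbox (l $ 1, l $ 2) (u $ 1, u $ 2)"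
  for l u :: "real^2"
  by (auto simp: mem_box_cart forall_2 mem_box Basis_prod_def)

text \<open>Lebesgue measure is determined by its values on boxes, and the map sends boxes to boxes
  with the same side lengths. This links iterated integrals over \<open>real \<times> real\<close>
  with integrals over \<open>real^2\<close>.\<close>

lemma distr_lborel_vector_2:
  "distr lborel borel (\<lambda>p :: real \<times> real. vector [fst p, snd p] :: real^2) = lborel"
proof (rule lborel_eqI[symmetric])
  let ?v = "\<lambda>p :: real \<times> real. vector [fst p, snd p] :: real^2"
  have meas: "?v \<in> borel_measurable borel"
    by (intro borel_measurable_continuous_onI linear_continuous_on bounded_linear_vector_2)
  fix l u :: "real^2"
  assume le: "\<And>b. b \<in> Basis \<Longrightarrow> l \<bullet> b \<le> u \<bullet> b"
  then have le: "l $ i \<le> u $ i" for i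
    by (metis axis_in_Basis_iff cart_eq_inner_axis insertI1 Basis_real_def singletonI)
  have "emeasure (distr lborel borel ?v) (box l u) = emeasure lborel (?v -` box l u)"
    using meas by (subst emeasure_distr) auto
  also have "?v -` box l u = box (l $ 1, l $ 2) (u $ 1, u $ 2)"
    by (auto simp: vector_2_mem_box)
  also have "emeasure lborel \<dots> = ennreal ((u $ 1 - l $ 1) * (u $ 2 - l $ 2))"
    using le by (subst emeasure_lborel_box) (auto simp: Basis_prod_def)
  also have "(u $ 1 - l $ 1) * (u $ 2 - l $ 2) = (\<Prod>b\<in>Basis. (u - l) \<bullet> b)"
  proof -
    have "(\<Prod>b\<in>Basis. (u - l) \<bullet> b) = (\<Prod>i\<in>UNIV. (u - l) $ i)"
      by (intro prod.reindex_bij_witness[of _ "\<lambda>i. axis i 1" "\<lambda>b. THE i. b = axis i 1"])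
        (auto simp: Basis_vec_def axis_eq_axis inner_axis)
    then show ?thesis by (simp add: UNIV_2)
  qed
  finally show "emeasure (distr lborel borel ?v) (box l u) = (\<Prod>b\<in>Basis. (u - l) \<bullet> b)" .
qed simp

text \<open>Fubini's theorem carried over to \<open>real^2\<close>. The detour through the Lebesgue
  integral lets the image measure be used.\<close>

lemma integral_cbox_vec_2:
  fixes g :: "real \<times> real \<Rightarrow> real" and a b c d :: real
  assumes "continuous_on (cbox (a, c) (b, d)) g"
  shows "integral (cbox (vector [a, c]) (vector [b, d])) (\<lambda>v :: real^2. g (v $ 1, v $ 2))
      = integral {a..b} (\<lambda>s. integral {c..d} (\<lambda>t. g (s, t)))"
proof -
  let ?v = "\<lambda>p :: real \<times> real. vector [fst p, snd p] :: real^2"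
  let ?B = "cbox (vector [a, c]) (vector [b, d]) :: (real^2) set"
  let ?C = "cbox (a, c) (b, d)"
  let ?G = "\<lambda>v :: real^2. g (v $ 1, v $ 2)"
  have meas: "?v \<in> lborel \<rightarrow>\<^sub>M borel"
    by (simp add: borel_measurable_continuous_onI linear_continuous_on bounded_linear_vector_2)
  have "continuous_on ?B ?G"
    by (rule continuous_on_compose2[OF assms])
      (auto intro!: continuous_intros simp: mem_box_cart forall_2 cbox_Pair_eq)
  then have G: "integrable lborel (\<lambda>v. indicator ?B v *\<^sub>R ?G v)"
    by (intro borel_integrable_compact) auto
  then have Gm: "(\<lambda>v. indicator ?B v *\<^sub>R ?G v) \<in> borel_measurable borel"
    by (simp add: borel_measurable_integrable)
  have g: "integrable lborel (\<lambda>p. indicator ?C p *\<^sub>R g p)"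
    using assms by (intro borel_integrable_compact) auto
  have "integral ?B ?G = (LINT v|lborel. indicator ?B v *\<^sub>R ?G v)"
    using set_borel_integral_eq_integral(2)[of ?B ?G] G
    by (simp add: set_integrable_def set_lebesgue_integral_def)
  also have "\<dots> = (LINT v|distr lborel borel ?v. indicator ?B v *\<^sub>R ?G v)"
    by (simp only: distr_lborel_vector_2)
  also have "\<dots> = (LINT p|lborel. indicator ?B (?v p) *\<^sub>R ?G (?v p))"
    by (rule integral_distr[OF meas Gm])
  also have "(\<lambda>p. indicator ?B (?v p) *\<^sub>R ?G (?v p)) = (\<lambda>p. indicator ?C p *\<^sub>R g p)"
    by (rule ext) (auto simp: indicator_def vector_2_mem_box)
  also have "(LINT p|lborel. indicator ?C p *\<^sub>R g p) = integral ?C g"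
    using set_borel_integral_eq_integral(2)[of ?C g] g
    by (simp add: set_integrable_def set_lebesgue_integral_def)
  also have "\<dots> = integral (cbox a b) (\<lambda>s. integral (cbox c d) (\<lambda>t. g (s, t)))"
    by (rule integral_prod_continuous[OF assms])
  finally show ?thesis by simp
qed

text \<open>A combination of \<open>axis\<close> vectors, so that the rules for differentiating sums
  and scalar multiples apply after unfolding.\<close>

definition unit_dir :: "real \<Rightarrow> real^2" where
  "unit_dir t = cos t *\<^sub>R axis 1 1 + sin t *\<^sub>R axis 2 1"

lemma unit_dir_nth [simp]: "unit_dir t $ 1 = cos t" "unit_dir t $ 2 = sin t"
  by (simp_all add: unit_dir_def axis_def)

lemma norm_vec_2: "norm (v :: real^2) = sqrt ((v $ 1)\<^sup>2 + (v $ 2)\<^sup>2)"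
  by (simp add: norm_vec_def L2_set_def UNIV_2)

lemma norm_unit_dir [simp]: "norm (unit_dir t) = 1"
  by (simp add: norm_vec_2)

lemma continuous_on_unit_dir [continuous_intros]:
  "continuous_on S f \<Longrightarrow> continuous_on S (\<lambda>x. unit_dir (f x))"
  unfolding unit_dir_def
  by (intro continuous_intros continuous_on_compose2[of UNIV cos S f] continuous_on_compose2[of UNIV sin S f])
    auto

text \<open>Angles with equal sine and cosine differ by a multiple of 2 pi, and two points of this
  open interval are less than 2 pi apart.\<close>

lemma unit_dir_inj:
  assumes "unit_dir s = unit_dir t" "s \<in> {-pi<..<pi}" "t \<in> {-pi<..<pi}"
  shows "s = t"
proof -
  have "sin s = sin t \<and> cos s = cos t"
    using assms(1) by (metis unit_dir_nth)
  then obtain n :: int where n: "s = t + 2 * pi * n"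
    by (auto simp: sin_cos_eq_iff)
  then have "\<bar>2 * pi * n\<bar> < 2 * pi * 1"
    using assms(2,3) by auto
  then have "\<bar>real_of_int n\<bar> < 1"
    by (simp add: abs_mult)
  then have "n = 0" by linarith
  then show ?thesis using n by simp
qed

lemma polar_form_2:
  fixes v :: "real^2"
  assumes "v \<noteq> 0"
  obtains t where "t \<in> {-pi<..pi}" "v = norm v *\<^sub>R unit_dir t"
proof -
  have "(v $ 1 / norm v)\<^sup>2 + (v $ 2 / norm v)\<^sup>2 = ((v $ 1)\<^sup>2 + (v $ 2)\<^sup>2) / (norm v)\<^sup>2"
    by (simp add: power_divide add_divide_distrib)
  also have "\<dots> = 1"
    using assms by (simp add: norm_vec_2 vec_eq_iff forall_2 add_nonneg_eq_0_iff)
  finally obtain y where y: "v $ 1 / norm v = cos y" "v $ 2 / norm v = sin y"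
    using sincos_total_2pi by metis
  obtain t where t: "-pi < t" "t \<le> pi" "sin t = sin y" "cos t = cos y"
    using sincos_principal_value[of y] by blast
  have "norm v * (v $ i / norm v) = v $ i" for i
    using assms by simp
  then have "v $ 1 = norm v * cos t" "v $ 2 = norm v * sin t"
    using y t(3,4) by metis+
  then have "v = norm v *\<^sub>R unit_dir t"
    unfolding vec_eq_iff forall_2 by (simp only: vector_scaleR_component unit_dir_nth real_scaleR_def)
  then show ?thesis
    using t(1,2) by (intro that[of t]) simp_all
qed

text \<open>The open rectangle misses only the centre and the ray at angle pi. Both lie on the
  horizontal line through \<open>x\<close>, which is a null set.\<close>

lemma polar_image:
  fixes x :: "real^2"
  defines "P \<equiv> \<lambda>v :: real^2. x + v $ 1 *\<^sub>R unit_dir (v $ 2)"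
  assumes "0 < r"
  shows "P ` box (vector [0, -pi]) (vector [r, pi]) \<subseteq> ball x r"
    and "ball x r - P ` box (vector [0, -pi]) (vector [r, pi]) \<subseteq> {y. y $ 2 = x $ 2}"
proof -
  show "P ` box (vector [0, -pi]) (vector [r, pi]) \<subseteq> ball x r"
    by (auto simp: P_def mem_box_cart forall_2 dist_norm)
  show "ball x r - P ` box (vector [0, -pi]) (vector [r, pi]) \<subseteq> {y. y $ 2 = x $ 2}"
  proof
    fix y assume y: "y \<in> ball x r - P ` box (vector [0, -pi]) (vector [r, pi])"
    show "y \<in> {y. y $ 2 = x $ 2}"
    proof (cases "y = x")
      case False
      then obtain t where t: "t \<in> {-pi<..pi}" "y - x = norm (y - x) *\<^sub>R unit_dir t"
        using polar_form_2[of "y - x"] by auto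
      then have yP: "y = P (vector [norm (y - x), t])"
        by (simp add: P_def algebra_simps)
      have "t = pi"
      proof (rule ccontr)
        assume "t \<noteq> pi"
        then have "vector [norm (y - x), t] \<in> box (vector [0, -pi]) (vector [r, pi] :: real^2)"
          using t y False by (auto simp: mem_box_cart forall_2 dist_norm norm_minus_commute)
        then show False using y yP by blast
      qed
      then have "(y - x) $ 2 = 0"
        using t(2) by (metis unit_dir_nth(2) sin_pi vector_scaleR_component mult_zero_right scaleR_zero_right real_scaleR_def)
      then show ?thesis by simp
    qed simp
  qed
qed

text \<open>The Jacobian and the integrand enter together as \<open>g\<close>, tied to
  \<open>f\<close> only for 0 < s < r. Thus \<open>f\<close> may be singular at the centre as long
  as the product extends continuously to the closed rectangle.\<close>

lemma integral_ball_polar: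
  fixes x :: "real^2" and f :: "real^2 \<Rightarrow> real" and g :: "real \<times> real \<Rightarrow> real"
  assumes "0 < r"
    and cont: "continuous_on (cbox (0, -pi) (r, pi)) g"
    and g: "\<And>s t. 0 < s \<Longrightarrow> s < r \<Longrightarrow> g (s, t) = s * f (x + s *\<^sub>R unit_dir t)"
  shows "integral (ball x r) f = integral {0..r} (\<lambda>s. integral {-pi..pi} (\<lambda>t. g (s, t)))"
proof -
  define S where "S = box (vector [0, -pi]) (vector [r, pi] :: real^2)"
  define P where "P v = x + v $ 1 *\<^sub>R unit_dir (v $ 2)" for v :: "real^2"
  define P' where "P' v h = h $ 1 *\<^sub>R unit_dir (v $ 2)
      + (v $ 1 * h $ 2) *\<^sub>R (- sin (v $ 2) *\<^sub>R axis 1 1 + cos (v $ 2) *\<^sub>R axis 2 1)"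
    for v h :: "real^2"
  let ?G = "\<lambda>v :: real^2. g (v $ 1, v $ 2)"
  \<comment> \<open>The change of variables theorem concerns vector-valued functions, so the real
    integrand passes through \<open>real^1\<close>.\<close>
  let ?lift = "vec :: real \<Rightarrow> real^1"
  have deriv: "(P has_derivative P' v) (at v within S)" for v
    unfolding P_def[abs_def] unit_dir_def
    by (rule derivative_eq_intros bounded_linear.has_derivative[OF bounded_linear_vec_nth] has_derivative_ident refl | simp)+
      (auto simp: P'_def unit_dir_def algebra_simps fun_eq_iff)
  have det: "det (matrix (P' v)) = v $ 1" for v
  proof -
    have "v $ 1 * (cos (v $ 2) * cos (v $ 2)) + v $ 1 * (sin (v $ 2) * sin (v $ 2)) = v $ 1"
      by (metis distrib_left mult_1_right sin_cos_squared_add3)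
    then show ?thesis
      unfolding det_2 by (simp add: matrix_def P'_def axis_def mult_ac)
  qed
  have inj: "inj_on P S"
  proof (rule inj_onI)
    fix v w assume vw: "v \<in> S" "w \<in> S" "P v = P w"
    then have pos: "0 < v $ 1" "0 < w $ 1" and ang: "v $ 2 \<in> {-pi<..<pi}" "w $ 2 \<in> {-pi<..<pi}"
      by (auto simp: S_def mem_box_cart forall_2)
    have eq: "v $ 1 *\<^sub>R unit_dir (v $ 2) = w $ 1 *\<^sub>R unit_dir (w $ 2)"
      using vw(3) by (simp add: P_def)
    then have "norm (v $ 1 *\<^sub>R unit_dir (v $ 2)) = norm (w $ 1 *\<^sub>R unit_dir (w $ 2))"
      by simp
    then have 1: "v $ 1 = w $ 1" using pos by simp
    then have "unit_dir (v $ 2) = unit_dir (w $ 2)" using eq pos by simp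
    then have "v $ 2 = w $ 2" using unit_dir_inj ang by blast
    then show "v = w" using 1 by (simp add: vec_eq_iff forall_2)
  qed
  have contG: "continuous_on (cbox (vector [0, -pi]) (vector [r, pi])) ?G"
    by (rule continuous_on_compose2[OF cont])
      (auto intro!: continuous_intros simp: mem_box_cart forall_2 cbox_Pair_eq)
  \<comment> \<open>Integrability comes from continuity on the compact rectangle and is transferred
    to \<open>f\<close> by the change of variables.\<close>
  have "?G absolutely_integrable_on cbox (vector [0, -pi]) (vector [r, pi])"
    by (rule absolutely_integrable_continuous[OF contG])
  then have "?G absolutely_integrable_on S"
    unfolding S_def by (rule set_integrable_subset) (auto simp: box_subset_cbox)
  moreover have Geq: "\<bar>det (matrix (P' v))\<bar> *\<^sub>R ?lift (f (P v)) = ?lift (?G v)" if "v \<in> S" for v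
    using that g[of "v $ 1" "v $ 2"]
    by (auto simp: det S_def mem_box_cart forall_2 P_def vec_eq_iff)
  ultimately have "(\<lambda>v. \<bar>det (matrix (P' v))\<bar> *\<^sub>R ?lift (f (P v))) absolutely_integrable_on S"
    by (subst set_integrable_cong[OF refl refl Geq])
      (simp_all add: absolutely_integrable_on_1_iff)
  moreover have "integral S (\<lambda>v. \<bar>det (matrix (P' v))\<bar> *\<^sub>R ?lift (f (P v))) = ?lift (integral S ?G)"
    by (subst integral_cong[OF Geq]) (simp_all add: integral_on_1_eq)
  ultimately have "integral (P ` S) (\<lambda>y. ?lift (f y)) = ?lift (integral S ?G)"
    using has_absolute_integral_change_of_variables[of S P P' "\<lambda>y. ?lift (f y)"] deriv inj
    by (auto simp: S_def)
  then have "integral (P ` S) f = integral S ?G"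
    by (simp add: integral_on_1_eq vec_eq_iff)
  moreover have "integral (P ` S) f = integral (ball x r) f"
  \<comment> \<open>The image and the disc differ by a subset of a line.\<close>
  proof (rule integral_spike_set)
    have "negligible {y :: real^2. y $ 2 = x $ 2}"
      using negligible_hyperplane[of "axis 2 1 :: real^2" "x $ 2"] by (simp add: inner_axis' axis_eq_0_iff)
    moreover have "{y \<in> P ` S - ball x r. f y \<noteq> 0} = {}"
      using polar_image(1)[OF \<open>0 < r\<close>, of x] by (auto simp: P_def S_def)
    moreover have "{y \<in> ball x r - P ` S. f y \<noteq> 0} \<subseteq> {y. y $ 2 = x $ 2}"
      using polar_image(2)[OF \<open>0 < r\<close>, of x] by (auto simp: P_def[abs_def] S_def)
    ultimately show "negligible {y \<in> P ` S - ball x r. f y \<noteq> 0}"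
        "negligible {y \<in> ball x r - P ` S. f y \<noteq> 0}"
      by (auto intro: negligible_subset)
  qed
  moreover have "integral S ?G = integral (cbox (vector [0, -pi]) (vector [r, pi])) ?G"
    unfolding S_def by (rule integral_open_interval)
  ultimately show ?thesis
    using integral_cbox_vec_2[OF cont] by simp
qed

subsection \<open>Integrals over circles of metaharmonic functions\<close>

text \<open>\<open>partial\<close> evaluates the Frechet derivative on basis vectors, so linearity
  recovers the whole derivative.\<close>

lemma has_derivative_partial:
  fixes f :: "real^2 \<Rightarrow> real"
  assumes "f differentiable (at y)"
  shows "(f has_derivative (\<lambda>h. h $ 1 * partial 1 f y + h $ 2 * partial 2 f y)) (at y)"
proof -
  let ?f' = "frechet_derivative f (at y)"
  have d: "(f has_derivative ?f') (at y)"
    using assms frechet_derivative_works by blast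
  then have lin: "linear ?f'"
    by (rule has_derivative_linear)
  have "?f' h = h $ 1 * partial 1 f y + h $ 2 * partial 2 f y" for h
  proof -
    have "h = h $ 1 *\<^sub>R axis 1 1 + h $ 2 *\<^sub>R axis 2 1"
      by (simp add: vec_eq_iff forall_2 axis_def)
    then have "?f' h = ?f' (h $ 1 *\<^sub>R axis 1 1 + h $ 2 *\<^sub>R axis 2 1)"
      by simp
    then show ?thesis
      by (simp add: linear_add[OF lin] linear_cmul[OF lin] partial_def)
  qed
  then have "?f' = (\<lambda>h. h $ 1 * partial 1 f y + h $ 2 * partial 2 f y)"
    by (rule ext)
  with d show ?thesis by simp
qed

lemma has_derivative_along_curve:
  fixes f :: "real^2 \<Rightarrow> real" and c :: "real \<Rightarrow> real^2"
  assumes "f differentiable (at (c s))" "(c has_vector_derivative c') (at s within A)"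
  shows "((\<lambda>s. f (c s)) has_real_derivative c' $ 1 * partial 1 f (c s) + c' $ 2 * partial 2 f (c s))
    (at s within A)"
proof -
  have "((f \<circ> c) has_derivative (\<lambda>h. h $ 1 * partial 1 f (c s) + h $ 2 * partial 2 f (c s)) \<circ> (\<lambda>h. h *\<^sub>R c'))
      (at s within A)"
    using assms by (intro diff_chain_within has_derivative_at_withinI[OF has_derivative_partial])
      (auto simp: has_vector_derivative_def)
  moreover have "(\<lambda>h. h $ 1 * partial 1 f (c s) + h $ 2 * partial 2 f (c s)) \<circ> (\<lambda>h. h *\<^sub>R c')
      = (*) (c' $ 1 * partial 1 f (c s) + c' $ 2 * partial 2 f (c s))"
    by (auto simp: fun_eq_iff algebra_simps)
  ultimately show ?thesis
    by (simp add: has_field_derivative_def o_def)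
qed

lemma radial_derivative:
  fixes f :: "real^2 \<Rightarrow> real"
  assumes "f differentiable (at (x + s *\<^sub>R unit_dir t))"
  shows "((\<lambda>s. f (x + s *\<^sub>R unit_dir t)) has_real_derivative
    cos t * partial 1 f (x + s *\<^sub>R unit_dir t) + sin t * partial 2 f (x + s *\<^sub>R unit_dir t)) (at s within A)"
proof -
  have "((\<lambda>s. x + s *\<^sub>R unit_dir t) has_vector_derivative unit_dir t) (at s within A)"
    by (auto intro!: derivative_eq_intros simp: has_vector_derivative_def)
  from has_derivative_along_curve[OF assms this] show ?thesis by simp
qed

lemma angular_derivative:
  fixes f :: "real^2 \<Rightarrow> real"
  assumes "f differentiable (at (x + s *\<^sub>R unit_dir t))"
  shows "((\<lambda>t. f (x + s *\<^sub>R unit_dir t)) has_real_derivative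
    s * (cos t * partial 2 f (x + s *\<^sub>R unit_dir t) - sin t * partial 1 f (x + s *\<^sub>R unit_dir t))) (at t within A)"
proof -
  let ?c' = "s *\<^sub>R (- sin t *\<^sub>R axis 1 1 + cos t *\<^sub>R axis 2 1) :: real^2"
  have "((\<lambda>t. x + s *\<^sub>R unit_dir t) has_derivative (\<lambda>h. h *\<^sub>R ?c')) (at t within A)"
    unfolding unit_dir_def
    by (rule derivative_eq_intros refl | simp)+ (auto simp: fun_eq_iff algebra_simps)
  then have "((\<lambda>t. x + s *\<^sub>R unit_dir t) has_vector_derivative ?c') (at t within A)"
    by (simp add: has_vector_derivative_def)
  from has_derivative_along_curve[OF assms this] show ?thesis
    by (rule DERIV_cong) (simp add: axis_def algebra_simps)
qed

lemma C1_on_imp_continuous_on: "C1_on D f \<Longrightarrow> continuous_on D f"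
  unfolding C1_on_def
  by (auto intro!: continuous_at_imp_continuous_on differentiable_imp_continuous_within)

text \<open>Averaging the polar form of the Helmholtz equation over the angle kills the angular
  derivatives by periodicity and leaves Bessel's equation.\<close>
lemma circle_integral_bessel_ode:
  fixes u :: "real^2 \<Rightarrow> real"
  defines "\<phi> \<equiv> \<lambda>x s. integral {-pi..pi} (\<lambda>t. u (x + s *\<^sub>R unit_dir t))"
  assumes C2: "C2_on D u" and sub: "cball x r \<subseteq> D"
    and helmholtz: "\<And>y. y \<in> cball x r \<Longrightarrow> laplacian u y + lam\<^sup>2 * u y = 0"
  obtains \<phi>1 \<phi>2 where
    "\<And>s. s \<in> {0..r} \<Longrightarrow> (\<phi> x has_real_derivative \<phi>1 s) (at s within {0..r})"
    "\<And>s. s \<in> {0..r} \<Longrightarrow> (\<phi>1 has_real_derivative \<phi>2 s) (at s within {0..r})"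
    "\<And>s. s \<in> {0<..<r} \<Longrightarrow> \<phi>1 s + s * \<phi>2 s = - lam\<^sup>2 * s * \<phi> x s"
    "\<phi>1 0 = 0"
proof
  define p where "p s t = x + s *\<^sub>R unit_dir t" for s t
  define u1 u2 where "u1 = partial 1 u" "u2 = partial 2 u"
  \<comment> \<open>\<open>F1\<close> and \<open>F2\<close> are the first and second derivatives of
    \<open>u\<close> along the ray at angle t; \<open>T1\<close> and \<open>T2\<close> are those in
    the angle at fixed radius s.\<close>
  define F1 where "F1 s t = cos t * u1 (p s t) + sin t * u2 (p s t)" for s t
  define F2 where "F2 s t =
      cos t * (cos t * partial 1 u1 (p s t) + sin t * partial 2 u1 (p s t))
    + sin t * (cos t * partial 1 u2 (p s t) + sin t * partial 2 u2 (p s t))" for s t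
  define T1 where "T1 s t = s * (cos t * u2 (p s t) - sin t * u1 (p s t))" for s t
  define T2 where "T2 s t = s * (
      cos t * (s * (cos t * partial 2 u2 (p s t) - sin t * partial 1 u2 (p s t))) - sin t * u2 (p s t)
    - (sin t * (s * (cos t * partial 2 u1 (p s t) - sin t * partial 1 u1 (p s t))) + cos t * u1 (p s t)))" for s t
  define \<phi>1 where "\<phi>1 s = integral (cbox (-pi) pi) (F1 s)" for s
  define \<phi>2 where "\<phi>2 s = integral (cbox (-pi) pi) (F2 s)" for s
  have C1: "C1_on D u" "C1_on D u1" "C1_on D u2"
    using C2 by (auto simp: C2_on_def u1_u2_def)
  have p_mem: "p s t \<in> cball x r" if "s \<in> {0..r}" for s t
    using that by (auto simp: p_def dist_norm)
  have p_D: "p s t \<in> D" if "s \<in> {0..r}" for s t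
    using p_mem[OF that] sub by blast
  have diff: "f differentiable (at (p s t))" if "C1_on D f" "s \<in> {0..r}" for f s t
    using that p_D by (auto simp: C1_on_def)
  have cont_p: "continuous_on A (\<lambda>z. h (p (fst z) (snd z)))"
    if "continuous_on D h" "A \<subseteq> {0..r} \<times> UNIV" for h :: "real^2 \<Rightarrow> real" and A
  proof (rule continuous_on_compose2[OF that(1)])
    show "continuous_on A (\<lambda>z. p (fst z) (snd z))"
      unfolding p_def by (intro continuous_intros)
    show "(\<lambda>z. p (fst z) (snd z)) ` A \<subseteq> D"
      using that(2) p_D by auto
  qed
  have cont: "continuous_on D u" "continuous_on D u1" "continuous_on D u2"
    using C1 by (auto intro: C1_on_imp_continuous_on)
  have cont': "continuous_on D (partial i u1)" "continuous_on D (partial i u2)" for i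
    using C1 by (auto simp: C1_on_def)
  let ?R = "{0..r} \<times> cbox (-pi) pi"
  \<comment> \<open>Joint continuity in radius and angle justifies differentiating twice under the
    integral sign.\<close>
  have cF: "continuous_on ?R (\<lambda>(s, t). u (p s t))"
    unfolding split_beta by (intro cont_p cont) auto
  have cF1: "continuous_on ?R (\<lambda>(s, t). F1 s t)"
    unfolding split_beta F1_def by (intro continuous_intros cont_p cont) auto
  have cF2: "continuous_on ?R (\<lambda>(s, t). F2 s t)"
    unfolding split_beta F2_def by (intro continuous_intros cont_p cont') auto
  have slice: "h s integrable_on cbox (-pi) pi"
    if "continuous_on ?R (\<lambda>(s, t). h s t)" "s \<in> {0..r}" for h :: "real \<Rightarrow> real \<Rightarrow> real" and s
  proof (rule integrable_continuous)
    show "continuous_on (cbox (-pi) pi) (h s)"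
    proof -
      have "continuous_on (cbox (-pi) pi) (\<lambda>t. case (s, t) of (s, t) \<Rightarrow> h s t)"
        by (rule continuous_on_compose2[OF that(1)]) (use that(2) in \<open>auto intro!: continuous_intros\<close>)
      then show ?thesis by simp
    qed
  qed
  have \<phi>_eq: "\<phi> x s = integral (cbox (-pi) pi) (\<lambda>t. u (p s t))" for s
    by (simp add: \<phi>_def p_def)
  show "(\<phi> x has_real_derivative \<phi>1 s) (at s within {0..r})" if s: "s \<in> {0..r}" for s
    unfolding \<phi>_eq[abs_def] \<phi>1_def
  proof (rule leibniz_rule_field_derivative[OF _ slice[OF cF] cF1 s])
    show "((\<lambda>s. u (p s t)) has_real_derivative F1 s t) (at s within {0..r})" if "s \<in> {0..r}" for s t
      using radial_derivative[of u x s t "{0..r}"] diff[OF C1(1) that, of t]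
      by (simp add: p_def F1_def u1_u2_def)
  qed auto
  show "(\<phi>1 has_real_derivative \<phi>2 s) (at s within {0..r})" if s: "s \<in> {0..r}" for s
    unfolding \<phi>1_def[abs_def] \<phi>2_def
  proof (rule leibniz_rule_field_derivative[OF _ slice[OF cF1] cF2 s])
    show "((\<lambda>s. F1 s t) has_real_derivative F2 s t) (at s within {0..r})" if "s \<in> {0..r}" for s t
      unfolding F1_def F2_def p_def
      using diff[OF C1(2) that, of t] diff[OF C1(3) that, of t]
      by (intro DERIV_add DERIV_cmult radial_derivative) (simp_all add: p_def)
  qed auto
  show "\<phi>1 s + s * \<phi>2 s = - lam\<^sup>2 * s * \<phi> x s" if "s \<in> {0<..<r}" for s
  proof -
    have s: "s \<in> {0..r}" "s \<noteq> 0" using that by auto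
    \<comment> \<open>\<open>T2\<close> is the angular derivative of \<open>T1\<close>, and
      \<open>T1\<close> takes the same value at -pi and pi.\<close>
    have "(T2 s has_integral (T1 s pi - T1 s (-pi))) {-pi..pi}"
    proof (rule fundamental_theorem_of_calculus)
      fix t
      have "(T1 s has_real_derivative T2 s t) (at t within {-pi..pi})"
        unfolding T1_def[abs_def] T2_def p_def
        using diff[OF C1(2) s(1), of t] diff[OF C1(3) s(1), of t]
        by (auto intro!: derivative_eq_intros angular_derivative simp: p_def algebra_simps)
      then show "(T1 s has_vector_derivative T2 s t) (at t within {-pi..pi})"
        by (simp add: has_real_derivative_iff_has_vector_derivative)
    qed simp
    moreover have "T1 s pi - T1 s (-pi) = 0"
      by (simp add: T1_def p_def unit_dir_def)
    ultimately have T: "(T2 s has_integral 0) (cbox (-pi) pi)"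
      by simp
    \<comment> \<open>The Laplacian in polar coordinates, multiplied by s^2. The mixed second
      derivatives cancel, and the first-order terms of \<open>T2\<close> cancel
      \<open>s * F1 s t\<close>.\<close>
    have pointwise: "s * F1 s t + s\<^sup>2 * F2 s t + T2 s t = - lam\<^sup>2 * s\<^sup>2 * u (p s t)" for t
    proof -
      have "s * F1 s t + s\<^sup>2 * F2 s t + T2 s t
          = s\<^sup>2 * (((sin t)\<^sup>2 + (cos t)\<^sup>2) * (partial 1 u1 (p s t) + partial 2 u2 (p s t)))"
        unfolding F1_def F2_def T2_def by (simp add: algebra_simps power2_eq_square
            del: sin_cos_squared_add sin_cos_squared_add2 sin_cos_squared_add3)
      also have "\<dots> = s\<^sup>2 * laplacian u (p s t)"
        by (simp add: laplacian_def UNIV_2 u1_u2_def)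
      also have "laplacian u (p s t) = - lam\<^sup>2 * u (p s t)"
        using helmholtz[OF p_mem[OF s(1)], of t] by simp
      finally show ?thesis by simp
    qed
    have "((\<lambda>t. s * F1 s t + s\<^sup>2 * F2 s t + T2 s t) has_integral
        s * \<phi>1 s + s\<^sup>2 * \<phi>2 s + 0) (cbox (-pi) pi)"
      unfolding \<phi>1_def \<phi>2_def
      by (intro has_integral_add has_integral_mult_right T integrable_integral slice[OF cF1] slice[OF cF2] s)
    then have "((\<lambda>t. - lam\<^sup>2 * s\<^sup>2 * u (p s t)) has_integral s * \<phi>1 s + s\<^sup>2 * \<phi>2 s + 0) (cbox (-pi) pi)"
      by (simp only: pointwise)
    moreover have "((\<lambda>t. - lam\<^sup>2 * s\<^sup>2 * u (p s t)) has_integral - lam\<^sup>2 * s\<^sup>2 * \<phi> x s) (cbox (-pi) pi)"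
      unfolding \<phi>_eq by (intro has_integral_mult_right integrable_integral slice[OF cF] s)
    ultimately have "s * \<phi>1 s + s\<^sup>2 * \<phi>2 s = - lam\<^sup>2 * s\<^sup>2 * \<phi> x s"
      using has_integral_unique by (metis add_0_right)
    then have "s * (\<phi>1 s + s * \<phi>2 s) = s * (- lam\<^sup>2 * s * \<phi> x s)"
      by (simp add: algebra_simps power2_eq_square)
    then show ?thesis using s(2) by (metis mult_left_cancel)
  qed
  show "\<phi>1 0 = 0"
  proof -
    \<comment> \<open>At radius 0 the partial derivatives are frozen at \<open>x\<close>, and sine
      and cosine integrate to 0 over a period.\<close>
    have "((\<lambda>t. cos t * u1 x + sin t * u2 x) has_integral
        (sin pi * u1 x - cos pi * u2 x) - (sin (-pi) * u1 x - cos (-pi) * u2 x)) {-pi..pi}"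
      by (rule fundamental_theorem_of_calculus)
        (auto intro!: derivative_eq_intros simp flip: has_real_derivative_iff_has_vector_derivative)
    then show ?thesis
      by (simp add: \<phi>1_def F1_def[abs_def] p_def integral_unique)
  qed
qed

section \<open>The logarithmically weighted mean value identity\<close>

theorem theorem5p2:
  fixes D :: "(real^2) set" and u :: "real^2 \<Rightarrow> real" and lam :: real
    and x :: "real^2" and r :: real
  assumes "open D" and "connected D"
    and "lam \<noteq> 0"
    and "C2_on D u"
    and "\<forall>y\<in>D. laplacian u y + lam\<^sup>2 * u y = 0"
    and "x \<in> D" and "r > 0" and "cball x r \<subseteq> D"
  shows "a_tilde (lam * r) * u x
           = 1 / (pi * r\<^sup>2) * integral (ball x r) (\<lambda>y. u y * ln (r / dist x y))"
proof -
  define \<phi> where "\<phi> s = integral {-pi..pi} (\<lambda>t. u (x + s *\<^sub>R unit_dir t))" for s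
  obtain \<phi>1 \<phi>2 where ode:
    "\<And>s. s \<in> {0..r} \<Longrightarrow> (\<phi> has_real_derivative \<phi>1 s) (at s within {0..r})"
    "\<And>s. s \<in> {0..r} \<Longrightarrow> (\<phi>1 has_real_derivative \<phi>2 s) (at s within {0..r})"
    "\<And>s. s \<in> {0<..<r} \<Longrightarrow> \<phi>1 s + s * \<phi>2 s = - lam\<^sup>2 * s * \<phi> s"
    "\<phi>1 0 = 0"
    unfolding \<phi>_def[abs_def]
    using circle_integral_bessel_ode[OF \<open>C2_on D u\<close> \<open>cball x r \<subseteq> D\<close>, of lam] assms(5,8) by blast
  note log_cont = continuous_on_mult_ln_div[OF \<open>r > 0\<close>]
  \<comment> \<open>The Jacobian s is grouped with the logarithm, which makes the integrand
    continuous up to s = 0.\<close>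
  let ?g = "\<lambda>(s, t). u (x + s *\<^sub>R unit_dir t) * (s * ln (r / s))"
  have \<phi>0: "\<phi> 0 = 2 * pi * u x"
    by (simp add: \<phi>_def)
  have \<phi>r: "\<phi> r = \<phi> 0 * bessel_J0 (lam * r)"
    using bessel_ode_unique[OF ode] assms by simp
  have "integral (ball x r) (\<lambda>y. u y * ln (r / dist x y))
      = integral {0..r} (\<lambda>s. integral {-pi..pi} (\<lambda>t. ?g (s, t)))"
  proof (rule integral_ball_polar[OF \<open>r > 0\<close>])
    show "continuous_on (cbox (0, -pi) (r, pi)) ?g"
      unfolding split_beta fst_conv snd_conv
    proof (rule continuous_on_mult)
      have "continuous_on D u"
        using \<open>C2_on D u\<close> by (simp add: C2_on_def C1_on_imp_continuous_on)
      then show "continuous_on (cbox (0, -pi) (r, pi)) (\<lambda>z. u (x + fst z *\<^sub>R unit_dir (snd z)))"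
      proof (rule continuous_on_compose2)
        have "(\<lambda>z. x + fst z *\<^sub>R unit_dir (snd z)) ` cbox (0, -pi) (r, pi) \<subseteq> cball x r"
          by (auto simp: cbox_Pair_eq dist_norm)
        then show "(\<lambda>z. x + fst z *\<^sub>R unit_dir (snd z)) ` cbox (0, -pi) (r, pi) \<subseteq> D"
          using assms(8) by blast
      qed (intro continuous_intros)
      have "continuous_on (cbox (0, -pi) (r, pi)) (\<lambda>z :: real \<times> real. fst z * ln (r / fst z))"
        by (rule continuous_on_compose2[OF log_cont]) (auto intro!: continuous_intros simp: cbox_Pair_eq)
      then show "continuous_on (cbox (0, -pi) (r, pi)) (\<lambda>z :: real \<times> real. fst z * ln (r / fst z))" .
    qed
  qed (simp add: dist_norm)
  also have "\<dots> = integral {0..r} (\<lambda>s. \<phi> s * (s * ln (r / s)))"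
    by (simp add: \<phi>_def)
  also have "\<dots> = (\<phi> 0 - \<phi> r) / lam\<^sup>2"
    using has_integral_log_weight_bessel_ode[OF ode(1-3) \<open>lam \<noteq> 0\<close> \<open>r > 0\<close> log_cont]
    by (rule integral_unique)
  also have "\<dots> = 2 * pi * u x * (1 - bessel_J0 (lam * r)) / lam\<^sup>2"
    by (simp add: \<phi>r \<phi>0 algebra_simps)
  finally have int: "integral (ball x r) (\<lambda>y. u y * ln (r / dist x y))
      = 2 * pi * u x * (1 - bessel_J0 (lam * r)) / lam\<^sup>2" .
  \<comment> \<open>Here \<open>w\<close> stands for 1 - J0(lam r); the factor pi cancels and both
    sides are 2 w u(x) / (lam r)^2.\<close>
  have "2 * w / (lam * r)\<^sup>2 * u x = 1 / (pi * r\<^sup>2) * (2 * pi * u x * w / lam\<^sup>2)" for w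
    by (simp add: power_mult_distrib mult_ac)
  then show ?thesis
    unfolding int a_tilde_def .
qed

end
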